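(* For any integers $k>m>0$, $F_{[k,m]}(x)=R_k(x)$.
   Context: A permutation $\alpha\in S_n$ contains a pattern $\tau\in S_k$ if there are indices $1\le i_1<\dots<i_k\le n$ with $(\alpha_{i_1},\dots,\alpha_{i_k})$ order-isomorphic to $\tau$; otherwise it avoids $\tau$. For a pattern $\tau$, $f_\tau(n)$ is the number of permutations in $S_n$ avoiding both $132$ and $\tau$ ($S_0$ consists of the empty permutation), and $F_\tau(x)=\sum_{n\ge0}f_\tau(n)x^n$. For $k>m>0$, $[k,m]$ denotes the permutation $(m+1,m+2,\dots,k,1,2,\dots,m)\in S_k$. $U_p$ is the Chebyshev polynomial of the second kind, $U_p(\cos\theta)=\sin((p+1)\theta)/\sin\theta$, and $R_p(x)=\dfrac{U_{p-1}\left(\frac1{2\sqrt x}\right)}{\sqrt x\,U_p\left(\frac1{2\sqrt x}\right)}$ (a rational function of $x$). *)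

theory Defs
  imports
    Complex_Main
    "HOL-Computational_Algebra.Computational_Algebra"
    "HOL-Combinatorics.Multiset_Permutations"
begin

text \<open>
  A permutation in $S_n$ is given in one-line notation, as a list in
  \<^term>\<open>permutations_of_set {1..n}\<close>. Lists are indexed from \<open>0\<close>, so a choice of positions
  $i_1 < \dots < i_k$ is a strictly increasing map on \<open>{..<k}\<close> with values below the length.
\<close>

definition contains_pattern :: "nat list \<Rightarrow> nat list \<Rightarrow> bool" where
  "contains_pattern \<alpha> \<tau> \<longleftrightarrow>
     (\<exists>i :: nat \<Rightarrow> nat.
        strict_mono_on {..<length \<tau>} i \<and>
        (\<forall>a < length \<tau>. i a < length \<alpha>) \<and>
        (\<forall>a < length \<tau>. \<forall>b < length \<tau>. \<alpha> ! i a < \<alpha> ! i b \<longleftrightarrow> \<tau> ! a < \<tau> ! b))"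

abbreviation avoids :: "nat list \<Rightarrow> nat list \<Rightarrow> bool" where
  "avoids \<alpha> \<tau> \<equiv> \<not> contains_pattern \<alpha> \<tau>"

definition avoid_count :: "nat list \<Rightarrow> nat \<Rightarrow> nat" where
  "avoid_count \<tau> n =
     card {\<alpha> \<in> permutations_of_set {1..n}. avoids \<alpha> [1, 3, 2] \<and> avoids \<alpha> \<tau>}"

definition avoid_gf :: "nat list \<Rightarrow> real fps" where
  "avoid_gf \<tau> = Abs_fps (\<lambda>n. real (avoid_count \<tau> n))"

definition two_block :: "nat \<Rightarrow> nat \<Rightarrow> nat list" where
  "two_block k m = [m + 1..<k + 1] @ [1..<m + 1]"

lemma two_block_permutation:
  assumes "m < k"
  shows   "two_block k m \<in> permutations_of_set {1..k}"
  using assms by (intro permutations_of_setI) (auto simp: two_block_def)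


text \<open>
  $U_p$ is the unique real polynomial with $U_p(\cos\theta) = \sin((p+1)\theta)/\sin\theta$;
  existence and uniqueness are \<open>poly_cheb_U_cos\<close> and \<open>poly_eqI_cos\<close>.
\<close>

definition cheb_U :: "nat \<Rightarrow> real poly" where
  "cheb_U p = (THE P. \<forall>\<theta>. sin \<theta> \<noteq> 0 \<longrightarrow> poly P (cos \<theta>) = sin (real (p + 1) * \<theta>) / sin \<theta>)"

fun cheb_U_rec :: "nat \<Rightarrow> real poly" where
  "cheb_U_rec 0 = 1"
| "cheb_U_rec (Suc 0) = [:0, 2:]"
| "cheb_U_rec (Suc (Suc p)) = [:0, 2:] * cheb_U_rec (Suc p) - cheb_U_rec p"

lemma poly_cheb_U_rec: "poly (cheb_U_rec p) (cos \<theta>) * sin \<theta> = sin (real (p + 1) * \<theta>)"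
proof (induction p rule: cheb_U_rec.induct)
  case 1
  show ?case by simp
next
  case 2
  show ?case by (simp add: sin_double)
next
  case (3 p)
  have "sin (real (p + 3) * \<theta>) + sin (real (p + 1) * \<theta>) = 2 * cos \<theta> * sin (real (p + 2) * \<theta>)"
  proof -
    have 1: "real (p + 3) * \<theta> = real (p + 2) * \<theta> + \<theta>" "real (p + 1) * \<theta> = real (p + 2) * \<theta> - \<theta>"
      by (simp_all add: algebra_simps)
    show ?thesis unfolding 1 sin_add sin_diff by simp
  qed
  moreover have "poly (cheb_U_rec (Suc (Suc p))) (cos \<theta>) * sin \<theta> =
      2 * cos \<theta> * (poly (cheb_U_rec (Suc p)) (cos \<theta>) * sin \<theta>) - poly (cheb_U_rec p) (cos \<theta>) * sin \<theta>"
    by (simp add: algebra_simps)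
  ultimately show ?case
    unfolding 3 by (simp add: numeral_eq_Suc)
qed

lemma poly_eqI_cos:
  fixes P Q :: "real poly"
  assumes "\<And>\<theta>. sin \<theta> \<noteq> 0 \<Longrightarrow> poly P (cos \<theta>) = poly Q (cos \<theta>)"
  shows   "P = Q"
proof (rule ccontr)
  assume "P \<noteq> Q"
  hence "finite {x. poly (P - Q) x = 0}"
    by (intro poly_roots_finite) auto
  moreover have "{-1<..<1} \<subseteq> {x. poly (P - Q) x = 0}"
  proof
    fix x :: real
    assume x: "x \<in> {-1<..<1}"
    have "sin (arccos x) \<noteq> 0"
      using x by (simp add: sin_arccos_nonzero)
    from assms[OF this] x show "x \<in> {x. poly (P - Q) x = 0}"
      by (simp add: cos_arccos)
  qed
  ultimately have "finite {-1<..<1::real}"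
    by (rule finite_subset[rotated])
  thus False
    using infinite_Ioo[of "-1" "1::real"] by simp
qed

lemma cheb_U_eq_rec: "cheb_U p = cheb_U_rec p"
  unfolding cheb_U_def
proof (rule the_equality)
  show *: "\<forall>\<theta>. sin \<theta> \<noteq> 0 \<longrightarrow> poly (cheb_U_rec p) (cos \<theta>) = sin (real (p + 1) * \<theta>) / sin \<theta>"
    using poly_cheb_U_rec[of p] by (simp add: eq_divide_eq)
  show "P = cheb_U_rec p"
    if "\<forall>\<theta>. sin \<theta> \<noteq> 0 \<longrightarrow> poly P (cos \<theta>) = sin (real (p + 1) * \<theta>) / sin \<theta>" for P
    using that * by (intro poly_eqI_cos) auto
qed

lemma poly_cheb_U_cos:
  "sin \<theta> \<noteq> 0 \<Longrightarrow> poly (cheb_U p) (cos \<theta>) = sin (real (p + 1) * \<theta>) / sin \<theta>"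
  using poly_cheb_U_rec[of p \<theta>] by (simp add: cheb_U_eq_rec eq_divide_eq)


text \<open>
  The defining expression of $R_p(x)$ involves $t = \sqrt x$. We read it in the field of formal
  Laurent series in \<open>t\<close>, where it denotes $R_p(t^2)$; \<open>R p\<close> is then the power series in \<open>x\<close> that
  becomes this Laurent series under $x = t^2$. For \<open>p > 0\<close> it exists, is unique
  (\<open>fps_compose_X2_inject\<close>) and is the expansion of a rational function (\<open>R_rational\<close>). The value
  at \<open>p = 0\<close> is irrelevant, since there \<open>p - 1\<close> is truncated subtraction.
\<close>

definition eval_at_fls :: "real poly \<Rightarrow> real fls \<Rightarrow> real fls" where
  "eval_at_fls P z = poly (map_poly fls_const P) z"

definition R_sqrt :: "nat \<Rightarrow> real fls" where
  "R_sqrt p = (let t = fls_X; z = 1 / (2 * t)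
               in eval_at_fls (cheb_U (p - 1)) z / (t * eval_at_fls (cheb_U p) z))"

definition R :: "nat \<Rightarrow> real fps" where
  "R p = (THE f. fps_to_fls (f oo fps_X ^ 2) = R_sqrt p)"

lemma map_poly_fls_const_diff:
  "map_poly fls_const (P - Q) = map_poly fls_const P - map_poly fls_const (Q :: real poly)"
  by (intro poly_eqI) (simp add: coeff_map_poly fls_minus_const)

lemma eval_at_fls_rec:
  "eval_at_fls ([:0, 2:] * P - Q) z = 2 * z * eval_at_fls P z - eval_at_fls Q z"
proof -
  have "[:0, 2:] * P = pCons 0 (smult 2 P)"
    by simp
  moreover have "map_poly fls_const (smult 2 P) = smult (fls_const 2) (map_poly fls_const P)"
    by (intro poly_eqI) (simp only: coeff_map_poly coeff_smult fls_const_0 fls_const_mult_const)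
  ultimately show ?thesis
    unfolding eval_at_fls_def map_poly_fls_const_diff
    by (simp add: map_poly_pCons)
qed

text \<open>$V_p(t^2) = t^p U_p(1/(2t))$, see \<open>eval_cheb_U\<close>.\<close>

fun cheb_V :: "nat \<Rightarrow> real poly" where
  "cheb_V 0 = 1"
| "cheb_V (Suc 0) = 1"
| "cheb_V (Suc (Suc p)) = cheb_V (Suc p) - [:0, 1:] * cheb_V p"

lemma coeff_0_cheb_V [simp]: "coeff (cheb_V p) 0 = 1"
  by (induction p rule: cheb_V.induct) auto

lemma eval_cheb_U:
  "fls_X ^ p * eval_at_fls (cheb_U p) (1 / (2 * fls_X)) =
     fps_to_fls (fps_of_poly (cheb_V p) oo fps_X ^ 2)"
  unfolding cheb_U_eq_rec
proof (induction p rule: cheb_V.induct)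
  case 1
  show ?case by (simp add: eval_at_fls_def)
next
  case 2
  show ?case
    by (simp add: eval_at_fls_def map_poly_pCons fls_X_times_conv_shift fls_shift_eq0_iff)
next
  case (3 p)
  let ?z = "1 / (2 * fls_X) :: real fls"
  let ?E = "\<lambda>p. eval_at_fls (cheb_U_rec p) ?z"
  have "fls_X ^ Suc (Suc p) * ?E (Suc (Suc p)) =
          fls_X ^ Suc (Suc p) * (2 * ?z) * ?E (Suc p) - fls_X ^ Suc (Suc p) * ?E p"
    unfolding cheb_U_rec.simps eval_at_fls_rec by (simp add: algebra_simps)
  also have "fls_X ^ Suc (Suc p) * (2 * ?z) = fls_X ^ Suc p"
  proof -
    have "a ^ Suc (Suc p) * (2 * (1 / (2 * a))) = a ^ Suc p" if "a \<noteq> 0" for a :: "real fls"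
      using that by simp
    from this[OF fls_X_nonzero] show ?thesis .
  qed
  also have "fls_X ^ Suc (Suc p) * ?E p = fls_X ^ 2 * (fls_X ^ p * ?E p)"
    by (simp add: power2_eq_square mult_ac)
  finally have "fls_X ^ Suc (Suc p) * ?E (Suc (Suc p)) =
      fps_to_fls (fps_of_poly (cheb_V (Suc p)) oo fps_X ^ 2)
      - fls_X ^ 2 * fps_to_fls (fps_of_poly (cheb_V p) oo fps_X ^ 2)"
    unfolding 3 .
  also have "fls_X ^ 2 = fps_to_fls (fps_X ^ 2 :: real fps)"
    by (simp add: fps_to_fls_power)
  also have "fps_of_poly (cheb_V (Suc (Suc p))) oo fps_X ^ 2 =
      (fps_of_poly (cheb_V (Suc p)) oo fps_X ^ 2) -
      fps_X ^ 2 * (fps_of_poly (cheb_V p) oo fps_X ^ 2)"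
    by (simp add: fps_of_poly_diff fps_of_poly_mult fps_compose_sub_distrib
          fps_compose_mult_distrib fps_of_poly_pCons)
  ultimately show ?case
    by (simp add: fls_times_fps_to_fls)
qed

lemma fps_compose_X2_inject:
  fixes f g :: "real fps"
  assumes "f oo fps_X ^ 2 = g oo fps_X ^ 2"
  shows   "f = g"
proof -
  have "(f - g) oo fps_X ^ 2 = 0"
    using assms by (simp add: fps_compose_sub_distrib)
  thus ?thesis
    by (simp add: fps_compose_eq_0_iff)
qed

lemma R_rational:
  assumes "p > 0"
  shows   "R p = fps_of_poly (cheb_V (p - 1)) / fps_of_poly (cheb_V p)" (is "_ = ?f")
    and   "fps_to_fls (R p oo fps_X ^ 2) = R_sqrt p"
proof -
  let ?W = "\<lambda>p. fps_of_poly (cheb_V p)"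
  let ?E = "\<lambda>p. eval_at_fls (cheb_U p) (1 / (2 * fls_X))"
  obtain q where q: "p = Suc q"
    using assms by (cases p) auto
  have unit: "fps_nth (?W p) 0 \<noteq> 0" by simp
  have "?f * ?W p = ?W (p - 1)"
    using unit by (simp add: fps_divide_unit mult.assoc inverse_mult_eq_1)
  hence "(?f oo fps_X ^ 2) * (?W p oo fps_X ^ 2) = ?W (p - 1) oo fps_X ^ 2"
    by (simp flip: fps_compose_mult_distrib)
  hence "fps_to_fls (?f oo fps_X ^ 2) * (fls_X ^ p * ?E p) = fls_X ^ (p - 1) * ?E (p - 1)"
    unfolding eval_cheb_U by (simp flip: fls_times_fps_to_fls)
  hence eq: "fps_to_fls (?f oo fps_X ^ 2) * (fls_X * ?E p) = ?E (p - 1)"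
    by (simp add: q mult_ac)
  have "?W p oo fps_X ^ 2 \<noteq> 0"
    using unit by (subst fps_compose_eq_0_iff) (auto, metis coeff_0 coeff_0_cheb_V zero_neq_one)
  hence "fls_X ^ p * ?E p \<noteq> 0"
    unfolding eval_cheb_U by simp
  hence nz: "fls_X * ?E p \<noteq> 0" by auto
  have *: "fps_to_fls (?f oo fps_X ^ 2) = R_sqrt p"
    unfolding R_sqrt_def Let_def nonzero_eq_divide_eq[OF nz] by (rule eq)
  have uniq: "g = ?f" if "fps_to_fls (g oo fps_X ^ 2) = R_sqrt p" for g
    by (rule fps_compose_X2_inject, rule fps_to_fls_eq_imp_fps_eq) (rule trans[OF that *[symmetric]])
  show "R p = ?f"
    unfolding R_def by (rule the_equality, rule *, erule uniq)
  thus "fps_to_fls (R p oo fps_X ^ 2) = R_sqrt p"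
    using * by (simp only:)
qed

end

theory Submission
  imports Defs "HOL-Library.Sublist"
begin

text \<open>
  A nonempty permutation avoiding \<open>132\<close> is \<open>u @ N # v\<close> with \<open>N\<close> its maximum, every entry of \<open>u\<close>
  larger than every entry of \<open>v\<close>, and \<open>u\<close>, \<open>v\<close> again avoiding \<open>132\<close>. An occurrence of $[k,m]$ that
  uses both \<open>v\<close> and \<open>u @ [N]\<close> must split exactly between the two blocks of the pattern. With
  $a = k - m$ and $G_j$ the generating function for the pattern $12\ldots j$, this gives
  $F = 1 + x (G_{a-1} F + F G_m - G_{a-1} G_m)$, and the same equation with $m = 0$ determines
  $G_a = V_{a-1} / V_a$. The addition formula
  $V_{a+m} = V_a V_m - x V_{a-1} V_{m-1}$ then yields $F = V_{k-1} / V_k$.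
\<close>

section \<open>Pattern occurrences as subsequences instead of index maps\<close>

text \<open>All earlier positions lie below \<open>i n\<close>, so the induction hypothesis applies
  to the prefix \<open>take (i n) ys\<close>, and the entry at position \<open>i n\<close> is then
  appended.\<close>

lemma subseq_map_nth:
  assumes "strict_mono_on {..<n} i" and "\<And>a. a < n \<Longrightarrow> i a < length ys"
  shows "subseq (map (\<lambda>a. ys ! i a) [0..<n]) ys"
  using assms
proof (induction n arbitrary: ys)
  case 0
  show ?case by simp
next
  case (Suc n)
  let ?zs = "take (i n) ys"
  have lt: "i a < i n" if "a < n" for a
    using that Suc.prems(1) by (auto simp: strict_mono_on_def)
  have n: "i n < length ys"
    using Suc.prems(2) by simp
  have "subseq (map (\<lambda>a. ?zs ! i a) [0..<n]) ?zs"
    using Suc.prems lt n by (intro Suc.IH) (auto simp: strict_mono_on_def)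
  also have "map (\<lambda>a. ?zs ! i a) [0..<n] = map (\<lambda>a. ys ! i a) [0..<n]"
    using lt by auto
  finally have "subseq (map (\<lambda>a. ys ! i a) [0..<n] @ [ys ! i n]) (?zs @ ys ! i n # drop (Suc (i n)) ys)"
    by (intro list_emb_append_mono) auto
  thus ?case
    using id_take_nth_drop[OF n] by simp
qed

lemma subseq_imp_index:
  assumes "subseq xs ys"
  shows "\<exists>i. strict_mono_on {..<length xs} i \<and> (\<forall>a<length xs. i a < length ys \<and> ys ! i a = xs ! a)"
  using assms
proof induction
  case (list_emb_Nil ys)
  show ?case by (auto simp: strict_mono_on_def)
next
  case (list_emb_Cons xs ys y)
  then obtain i where "strict_mono_on {..<length xs} i"
    "\<forall>a<length xs. i a < length ys \<and> ys ! i a = xs ! a" by blast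
  thus ?case
    by (intro exI[of _ "Suc \<circ> i"]) (auto simp: strict_mono_on_def)
next
  case (list_emb_Cons2 x y xs ys)
  then obtain i where "strict_mono_on {..<length xs} i"
    "\<forall>a<length xs. i a < length ys \<and> ys ! i a = xs ! a" by blast
  \<comment> \<open>The matched head sits at position 0; the positions for the tail move up by
    one.\<close>
  thus ?case using list_emb_Cons2
    by (intro exI[of _ "case_nat 0 (Suc \<circ> i)"])
       (auto simp: strict_mono_on_def nth_Cons less_Suc_eq_0_disj split: nat.splits)
qed

text \<open>With occurrences as subsequences, cutting one at a given place of the permutation
  becomes splitting a subsequence of an append.\<close>

lemma contains_pattern_iff_subseq:
  "contains_pattern \<alpha> \<tau> \<longleftrightarrow>
     (\<exists>s. subseq s \<alpha> \<and> length s = length \<tau> \<and>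
          (\<forall>a<length \<tau>. \<forall>b<length \<tau>. s ! a < s ! b \<longleftrightarrow> \<tau> ! a < \<tau> ! b))"
    (is "_ \<longleftrightarrow> ?R")
proof
  assume "contains_pattern \<alpha> \<tau>"
  then obtain i where i: "strict_mono_on {..<length \<tau>} i" "\<forall>a<length \<tau>. i a < length \<alpha>"
    "\<forall>a<length \<tau>. \<forall>b<length \<tau>. \<alpha> ! i a < \<alpha> ! i b \<longleftrightarrow> \<tau> ! a < \<tau> ! b"
    by (auto simp: contains_pattern_def)
  thus ?R
    using subseq_map_nth[OF i(1), of \<alpha>]
    by (intro exI[of _ "map (\<lambda>a. \<alpha> ! i a) [0..<length \<tau>]"]) auto
next
  assume ?R
  then obtain s where s: "subseq s \<alpha>" "length s = length \<tau>"
    "\<forall>a<length \<tau>. \<forall>b<length \<tau>. s ! a < s ! b \<longleftrightarrow> \<tau> ! a < \<tau> ! b" by blast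
  show "contains_pattern \<alpha> \<tau>"
    using subseq_imp_index[OF s(1)] s(2,3) unfolding contains_pattern_def by metis
qed

section \<open>The two patterns as order conditions on subsequences\<close>

definition has_132 :: "nat list \<Rightarrow> bool" where
  "has_132 \<gamma> \<longleftrightarrow> (\<exists>a b c. subseq [a, b, c] \<gamma> \<and> a < c \<and> c < b)"

text \<open>
  Containment of $[a + m, m]$; for \<open>m = 0\<close> it is the existence of an increasing subsequence of
  length \<open>a\<close>.
\<close>

definition has_blocks :: "nat \<Rightarrow> nat \<Rightarrow> nat list \<Rightarrow> bool" where
  "has_blocks a m \<gamma> \<longleftrightarrow>
     (\<exists>xs ys. length xs = a \<and> length ys = m \<and> subseq (xs @ ys) \<gamma> \<and> sorted_wrt (<) (ys @ xs))"

lemma contains_132_iff: "contains_pattern \<gamma> [1, 3, 2] \<longleftrightarrow> has_132 \<gamma>"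
proof -
  have "contains_pattern \<gamma> [1, 3, 2] \<longleftrightarrow> (\<exists>s. subseq s \<gamma> \<and> length s = 3 \<and> s ! 0 < s ! 2 \<and> s ! 2 < s ! 1)"
    unfolding contains_pattern_iff_subseq
    by (rule arg_cong[of _ _ Ex], rule ext) (auto simp: numeral_eq_Suc All_less_Suc)
  also have "\<dots> \<longleftrightarrow> has_132 \<gamma>"
    unfolding has_132_def
  proof safe
    fix s assume s: "subseq s \<gamma>" "length s = 3" "s ! 0 < s ! 2" "s ! 2 < s ! 1"
    then have "s = [s ! 0, s ! 1, s ! 2]"
      by (auto simp: numeral_eq_Suc length_Suc_conv)
    thus "\<exists>a b c. subseq [a, b, c] \<gamma> \<and> a < c \<and> c < b"
      using s by metis
  next
    fix a b c assume "subseq [a, b, c] \<gamma>" "a < c" "c < b"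
    thus "\<exists>s. subseq s \<gamma> \<and> length s = 3 \<and> s ! 0 < s ! 2 \<and> s ! 2 < s ! 1"
      by (intro exI[of _ "[a, b, c]"]) auto
  qed
  finally show ?thesis .
qed

text \<open>Swapping the two blocks turns the pattern into the identity, so order-isomorphism to it
  means that the swapped list is increasing.\<close>

lemma order_iso_two_block_iff:
  fixes s :: "nat list"
  assumes "length s = a + m"
  shows "(\<forall>p<a + m. \<forall>q<a + m. s ! p < s ! q \<longleftrightarrow> two_block (a + m) m ! p < two_block (a + m) m ! q)
           \<longleftrightarrow> sorted_wrt (<) (drop a s @ take a s)" (is "?L \<longleftrightarrow> sorted_wrt (<) ?r")
proof -
  \<comment> \<open>the rank of the entry at position \<open>p\<close>, counted from \<open>0\<close>\<close>
  define \<sigma> where "\<sigma> p = (if p < a then p + m else p - a)" for p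
  have t: "two_block (a + m) m ! p = Suc (\<sigma> p)" if "p < a + m" for p
    using that by (auto simp: two_block_def \<sigma>_def nth_append)
  have s: "s ! p = ?r ! \<sigma> p" if "p < a + m" for p
    using that assms by (auto simp: \<sigma>_def nth_append)
  have img: "\<sigma> ` {..<a + m} = {..<a + m}"
  proof (intro equalityI subsetI)
    fix i assume "i \<in> {..<a + m}"
    thus "i \<in> \<sigma> ` {..<a + m}"
      \<comment> \<open>The witness is the position whose rank is \<open>i\<close>, that is, the
        inverse of \<open>\<sigma>\<close>.\<close>
      by (intro image_eqI[of _ _ "if i < m then i + a else i - m"]) (auto simp: \<sigma>_def)
  qed (auto simp: \<sigma>_def)
  \<comment> \<open>Quantification over positions is replaced by quantification over ranks; as
    \<open>\<sigma>\<close> permutes the index set, this loses nothing.\<close>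
  have "?L \<longleftrightarrow> (\<forall>i\<in>\<sigma> ` {..<a + m}. \<forall>j\<in>\<sigma> ` {..<a + m}. ?r ! i < ?r ! j \<longleftrightarrow> i < j)"
    by (auto simp: t s)
  also have "\<dots> \<longleftrightarrow> (\<forall>i<a + m. \<forall>j<a + m. ?r ! i < ?r ! j \<longleftrightarrow> i < j)"
    unfolding img by (simp add: Ball_def)
  also have "\<dots> \<longleftrightarrow> sorted_wrt (<) ?r"
  proof
    assume *: "\<forall>i<a + m. \<forall>j<a + m. ?r ! i < ?r ! j \<longleftrightarrow> i < j"
    show "sorted_wrt (<) ?r"
      unfolding sorted_wrt_iff_nth_less using * assms by simp
  next
    assume "sorted_wrt (<) ?r"
    hence *: "?r ! i < ?r ! j" if "i < j" "j < a + m" for i j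
      using that assms sorted_wrt_nth_less[of "(<)" ?r i j] by simp
    have "?r ! i < ?r ! j \<longleftrightarrow> i < j" if "i < a + m" "j < a + m" for i j
      using *[of i j] *[of j i] that by (cases i j rule: linorder_cases) auto
    thus "\<forall>i<a + m. \<forall>j<a + m. ?r ! i < ?r ! j \<longleftrightarrow> i < j"
      by blast
  qed
  finally show ?thesis .
qed

lemma contains_two_block_iff:
  "contains_pattern \<gamma> (two_block (a + m) m) \<longleftrightarrow> has_blocks a m \<gamma>"
proof -
  have len: "length (two_block (a + m) m) = a + m"
    by (simp add: two_block_def)
  have "contains_pattern \<gamma> (two_block (a + m) m) \<longleftrightarrow>
      (\<exists>s. subseq s \<gamma> \<and> length s = a + m \<and> sorted_wrt (<) (drop a s @ take a s))"
    unfolding contains_pattern_iff_subseq len using order_iso_two_block_iff by blast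
  also have "\<dots> \<longleftrightarrow> has_blocks a m \<gamma>"
    unfolding has_blocks_def
  proof safe
    fix s assume "subseq s \<gamma>" "length s = a + m" "sorted_wrt (<) (drop a s @ take a s)"
    thus "\<exists>xs ys. length xs = a \<and> length ys = m \<and> subseq (xs @ ys) \<gamma> \<and> sorted_wrt (<) (ys @ xs)"
      by (intro exI[of _ "take a s"] exI[of _ "drop a s"]) auto
  next
    fix xs ys :: "nat list"
    assume "subseq (xs @ ys) \<gamma>" "sorted_wrt (<) (ys @ xs)"
    thus "\<exists>s. subseq s \<gamma> \<and> length s = length xs + length ys \<and>
               sorted_wrt (<) (drop (length xs) s @ take (length xs) s)"
      by (intro exI[of _ "xs @ ys"]) auto
  qed
  finally show ?thesis .
qed

section \<open>Invariance under shifts and monotonicity\<close>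

lemma set_subseq: "subseq xs ys \<Longrightarrow> set xs \<subseteq> set ys"
  by (auto simp: subseq_conv_nths dest: in_set_nthsD)

lemma subseq_map_iff: "subseq xs (map f ys) \<longleftrightarrow> (\<exists>zs. xs = map f zs \<and> subseq zs ys)"
  by (auto simp: subseq_conv_nths nths_map)

lemma has_132_shift [simp]: "has_132 (map (\<lambda>x. x + j) \<alpha>) \<longleftrightarrow> has_132 \<alpha>"
proof
  show "has_132 (map (\<lambda>x. x + j) \<alpha>) \<Longrightarrow> has_132 \<alpha>"
    by (fastforce simp: has_132_def subseq_map_iff Cons_eq_map_conv)
  assume "has_132 \<alpha>"
  then obtain a b c where "subseq [a, b, c] \<alpha>" "a < c" "c < b"
    by (auto simp: has_132_def)
  thus "has_132 (map (\<lambda>x. x + j) \<alpha>)"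
    using subseq_map[of "[a, b, c]" \<alpha> "\<lambda>x. x + j"] unfolding has_132_def
    by (intro exI[of _ "a + j"] exI[of _ "b + j"] exI[of _ "c + j"]) simp
qed

lemma has_blocks_shift [simp]: "has_blocks a m (map (\<lambda>x. x + j) \<alpha>) \<longleftrightarrow> has_blocks a m \<alpha>"
proof
  assume "has_blocks a m (map (\<lambda>x. x + j) \<alpha>)"
  thus "has_blocks a m \<alpha>"
    by (fastforce simp: has_blocks_def subseq_map_iff append_eq_map_conv sorted_wrt_map sorted_wrt_append)
next
  assume "has_blocks a m \<alpha>"
  then obtain xs ys where "length xs = a" "length ys = m" "subseq (xs @ ys) \<alpha>" "sorted_wrt (<) (ys @ xs)"
    by (auto simp: has_blocks_def)
  thus "has_blocks a m (map (\<lambda>x. x + j) \<alpha>)"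
    using subseq_map[of "xs @ ys" \<alpha> "\<lambda>x. x + j"] unfolding has_blocks_def
    by (intro exI[of _ "map (\<lambda>x. x + j) xs"] exI[of _ "map (\<lambda>x. x + j) ys"])
       (simp add: sorted_wrt_map sorted_wrt_append)
qed

lemma has_132_mono: "has_132 xs \<Longrightarrow> subseq xs ys \<Longrightarrow> has_132 ys"
  unfolding has_132_def using subseq_order.order_trans by blast

lemma has_blocks_mono: "has_blocks a m xs \<Longrightarrow> subseq xs ys \<Longrightarrow> has_blocks a m ys"
  unfolding has_blocks_def using subseq_order.order_trans by blast

section \<open>Occurrences in a list split at its maximum\<close>

lemma subseq_join_parts: "subseq u (u @ N # v)" "subseq v (u @ N # v)"
  by (simp add: prefix_imp_subseq) (auto intro!: list_emb_append2 list_emb_Cons)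

text \<open>An occurrence that meets both sides of the cut would begin in \<open>u\<close> and end
  in \<open>v\<close>, but then its last entry is below its first. The maximum can only be the
  middle entry, so it creates no new occurrence.\<close>

lemma has_132_join:
  assumes top: "\<forall>x\<in>set u \<union> set v. x < N" and lt: "\<forall>x\<in>set u. \<forall>y\<in>set v. y < x"
  shows "has_132 (u @ N # v) \<longleftrightarrow> has_132 u \<or> has_132 v"
proof
  assume "has_132 (u @ N # v)"
  then obtain a b c where abc: "subseq [a, b, c] (u @ N # v)" "a < c" "c < b"
    by (auto simp: has_132_def)
  have le: "x \<le> N" if "x \<in> set (u @ N # v)" for x
    using that top by (auto intro: less_imp_le)
  have "b \<le> N"
    using abc(1) by (intro le) (auto dest!: set_subseq)
  obtain s t where st: "[a, b, c] = s @ t" "subseq s u" "subseq t (N # v)"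
    using abc(1) by (auto simp: subseq_append_iff)
  have sub: "set s \<subseteq> set u" "set t \<subseteq> insert N (set v)"
    using st(2,3) by (auto dest!: set_subseq)
  show "has_132 u \<or> has_132 v"
  proof (cases "s = [] \<or> t = []")
    case True
    thus ?thesis
    proof
      assume "s = []"
      hence "subseq [a, b, c] (N # v)"
        using st by simp
      \<comment> \<open>\<open>a\<close> is the least of the three entries and \<open>N\<close>
        bounds them all, so dropping \<open>N\<close> from the list loses nothing.\<close>
      moreover have "a \<noteq> N"
        using abc \<open>b \<le> N\<close> by simp
      ultimately have "subseq [a, b, c] v"
        by (simp only: subseq_Cons2_iff if_False)
      thus ?thesis
        using abc(2,3) unfolding has_132_def by blast
    next
      assume "t = []"
      hence "subseq [a, b, c] u"
        using st by simp
      thus ?thesis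
        using abc(2,3) unfolding has_132_def by blast
    qed
  next
    case False
    hence "hd s \<in> set u" "last t \<in> insert N (set v)"
      using sub hd_in_set last_in_set by blast+
    moreover have "hd [a, b, c] = hd s" "last [a, b, c] = last t"
      unfolding st(1) using False by simp_all
    \<comment> \<open>The alternative \<open>c = N\<close> is excluded by \<open>c < b\<close> and
      \<open>b \<le> N\<close>.\<close>
    ultimately have "a \<in> set u" "c \<in> set v"
      using abc(3) \<open>b \<le> N\<close> by auto
    hence "c < a"
      using lt by blast
    thus ?thesis using abc(2) by simp
  qed
next
  assume "has_132 u \<or> has_132 v"
  thus "has_132 (u @ N # v)"
    using has_132_mono subseq_join_parts by blast
qed

text \<open>Entries before the cut exceed those after it, whereas each block increases from left to
  right. Hence a cut meeting both sides falls exactly between the blocks, and \<open>N\<close> can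
  serve as the last entry of the first block. This is why only length \<open>a - 1\<close> is
  required of \<open>u\<close>.\<close>

lemma has_blocks_join:
  assumes top: "\<forall>x\<in>set u \<union> set v. x < N" and lt: "\<forall>x\<in>set u. \<forall>y\<in>set v. y < x" and "a > 0"
  shows "has_blocks a m (u @ N # v) \<longleftrightarrow>
     has_blocks a m u \<or> has_blocks a m v \<or> has_blocks (a - 1) 0 u \<and> has_blocks m 0 v"
proof
  assume "has_blocks a m (u @ N # v)"
  then obtain xs ys where xy: "length xs = a" "length ys = m" "subseq (xs @ ys) ((u @ [N]) @ v)"
    "sorted_wrt (<) (ys @ xs)"
    by (auto simp: has_blocks_def)
  obtain s t where st: "xs @ ys = s @ t" "subseq s (u @ [N])" "subseq t v"
    using xy(3) by (rule subseq_appendE)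
  have sub: "set s \<subseteq> insert N (set u)" "set t \<subseteq> set v"
    using st(2,3) by (auto dest!: set_subseq)
  have ts: "y < x" if "x \<in> set s" "y \<in> set t" for x y
    using that sub lt top by auto
  have le: "x \<le> N" if "x \<in> set s" for x
    using that sub(1) top by (auto intro: less_imp_le)
  \<comment> \<open>Here the cut lies after \<open>N\<close>. The list \<open>w\<close> is the part
    of the occurrence between this cut and the boundary of the two blocks; it is empty when they
    coincide.\<close>
  obtain w where w: "xs = s @ w \<and> t = w @ ys \<or> s = xs @ w \<and> ys = w @ t"
    using st(1) by (auto simp: append_eq_append_conv2)
  show "has_blocks a m u \<or> has_blocks a m v \<or> has_blocks (a - 1) 0 u \<and> has_blocks m 0 v"
  proof (cases "w = []")
    case True
    hence xs: "subseq xs (u @ [N])" "subseq ys v"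
      using w st by auto
    then obtain p q where pq: "xs = p @ q" "subseq p u" "subseq q [N]"
      by (elim subseq_appendE)
    \<comment> \<open>At most the last entry of \<open>xs\<close> is \<open>N\<close>, so the first
      \<open>a - 1\<close> entries come from \<open>u\<close>.\<close>
    have "length q \<le> 1"
      using list_emb_length[OF pq(3)] by simp
    hence "take (a - 1) xs = take (a - 1) p"
      using pq(1) xy(1) by auto
    hence "subseq (take (a - 1) xs) p"
      by (simp add: prefix_imp_subseq take_is_prefix)
    hence "subseq (take (a - 1) xs) u"
      using pq(2) subseq_order.order_trans by blast
    moreover have "sorted_wrt (<) (take (a - 1) xs)"
      using xy(4) by (simp add: sorted_wrt_append sorted_wrt_take)
    ultimately have "has_blocks (a - 1) 0 u"
      using xy(1) unfolding has_blocks_def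
      by (intro exI[of _ "take (a - 1) xs"] exI[of _ "[]"]) auto
    moreover have "has_blocks m 0 v"
      using xy xs(2) unfolding has_blocks_def
      by (intro exI[of _ ys] exI[of _ "[]"]) (auto simp: sorted_wrt_append)
    ultimately show ?thesis by blast
  next
    case False
    from w show ?thesis
    proof (elim disjE conjE)
      assume eq: "xs = s @ w" "t = w @ ys"
      \<comment> \<open>The cut would run through the first block: \<open>hd s\<close> precedes
        \<open>hd w\<close> in an increasing list, yet lies on the larger side.\<close>
      have "s = []"
      proof (rule ccontr)
        assume "s \<noteq> []"
        hence "hd s < hd w" "hd w < hd s"
          using False xy(4) eq ts[of "hd s" "hd w"] by (auto simp: sorted_wrt_append)
        thus False by simp
      qed
      thus ?thesis
        using xy st eq unfolding has_blocks_def by auto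
    next
      assume eq: "s = xs @ w" "ys = w @ t"
      \<comment> \<open>The same contradiction for a cut through the second block; afterwards the
        whole occurrence lies in \<open>u @ [N]\<close>.\<close>
      have "t = []"
      proof (rule ccontr)
        assume "t \<noteq> []"
        hence "hd w < hd t" "hd t < hd w"
          using False xy(4) eq ts[of "hd w" "hd t"] by (auto simp: sorted_wrt_append)
        thus False by simp
      qed
      then obtain p q where pq: "xs @ ys = p @ q" "subseq p u" "subseq q [N]"
        using st by (auto elim: subseq_appendE)
      \<comment> \<open>If \<open>N\<close> were used, it would end the second block and so be
        smaller than the first block, against maximality.\<close>
      have "q = []"
      proof (rule ccontr)
        assume "q \<noteq> []"
        hence q: "q = [N]"
          using pq(3) list_emb_length[OF pq(3)] by (cases q) (auto split: if_splits)
        hence "last ys = N"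
          using pq(1) False eq by (metis append_is_Nil_conv last_appendR last_snoc)
        moreover have "last ys < hd xs"
        proof -
          have "ys \<noteq> []" "xs \<noteq> []"
            using xy(1) False eq \<open>a > 0\<close> by auto
          hence "last ys \<in> set ys" "hd xs \<in> set xs"
            by simp_all
          thus ?thesis
            using xy(4) unfolding sorted_wrt_append by blast
        qed
        moreover have "hd xs \<le> N"
          using xy(1) eq \<open>a > 0\<close> by (intro le) auto
        ultimately show False by simp
      qed
      thus ?thesis
        using pq xy unfolding has_blocks_def by auto
    qed
  qed
next
  assume "has_blocks a m u \<or> has_blocks a m v \<or> has_blocks (a - 1) 0 u \<and> has_blocks m 0 v"
  thus "has_blocks a m (u @ N # v)"
  proof (elim disjE conjE)
    assume "has_blocks (a - 1) 0 u" "has_blocks m 0 v"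
    then obtain xs ys where xy: "length xs = a - 1" "length ys = m" "subseq xs u" "subseq ys v"
      "sorted_wrt (<) xs" "sorted_wrt (<) ys"
      by (auto simp: has_blocks_def)
    have "set xs \<subseteq> set u" "set ys \<subseteq> set v"
      using xy by (auto dest!: set_subseq)
    hence "\<forall>x\<in>set xs. \<forall>y\<in>set ys. y < x" "\<forall>x\<in>set xs \<union> set ys. x < N"
      using top lt by blast+
    \<comment> \<open>\<open>N\<close> supplies the missing last entry of the first block.\<close>
    hence "sorted_wrt (<) (ys @ (xs @ [N]))"
      using xy(5,6) by (auto simp: sorted_wrt_append)
    moreover have "subseq ((xs @ [N]) @ ys) (u @ N # v)"
      using xy by (auto intro: list_emb_append_mono)
    ultimately show ?thesis
      using xy(1,2) \<open>a > 0\<close> unfolding has_blocks_def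
      by (intro exI[of _ "xs @ [N]"] exI[of _ ys]) auto
  qed (erule has_blocks_mono, rule subseq_join_parts)+
qed

section \<open>Decomposition of 132-avoiding permutations at the maximum\<close>

definition avoiders :: "nat \<Rightarrow> nat list set" where
  "avoiders n = {\<gamma> \<in> permutations_of_set {1..n}. \<not> has_132 \<gamma>}"

text \<open>The shift puts the values of \<open>\<alpha>\<close> just above those of
  \<open>\<beta>\<close>, which is the order that avoiding 132 forces around the maximum.\<close>

definition join :: "nat list \<Rightarrow> nat list \<Rightarrow> nat list" where
  "join \<alpha> \<beta> = map (\<lambda>x. x + length \<beta>) \<alpha> @ Suc (length \<alpha> + length \<beta>) # \<beta>"

lemma finite_avoiders [simp]: "finite (avoiders n)"
  by (simp add: avoiders_def)

lemma avoiders_iff: "\<gamma> \<in> avoiders n \<longleftrightarrow> set \<gamma> = {1..n} \<and> distinct \<gamma> \<and> \<not> has_132 \<gamma>"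
  by (auto simp: avoiders_def permutations_of_set_def)

lemma length_avoiders: "\<gamma> \<in> avoiders n \<Longrightarrow> length \<gamma> = n"
  using distinct_card[of \<gamma>] by (auto simp: avoiders_iff)

lemma avoiders_0: "avoiders 0 = {[]}"
  by (auto simp: avoiders_iff has_132_def)

context
  fixes \<alpha> \<beta> :: "nat list" and i j :: nat
  assumes \<alpha>: "\<alpha> \<in> avoiders i" and \<beta>: "\<beta> \<in> avoiders j"
begin

lemma set_shift_avoiders: "set (map (\<lambda>x. x + length \<beta>) \<alpha>) = {j + 1..i + j}"
proof -
  have "set (map (\<lambda>x. x + length \<beta>) \<alpha>) = (\<lambda>x. x + j) ` {1..i}"
    using \<alpha> length_avoiders[OF \<beta>] by (simp add: avoiders_iff)
  thus ?thesis
    by (simp add: image_add_atLeastAtMost' add.commute)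
qed

lemma join_bounds:
  "\<forall>x\<in>set (map (\<lambda>x. x + length \<beta>) \<alpha>) \<union> set \<beta>. x < Suc (length \<alpha> + length \<beta>)"
  "\<forall>x\<in>set (map (\<lambda>x. x + length \<beta>) \<alpha>). \<forall>y\<in>set \<beta>. y < x"
  using \<beta> length_avoiders[OF \<alpha>] length_avoiders[OF \<beta>] unfolding set_shift_avoiders
  by (auto simp: avoiders_iff)

lemma join_in_avoiders: "join \<alpha> \<beta> \<in> avoiders (Suc (i + j))"
proof -
  have "set (join \<alpha> \<beta>) = {j + 1..i + j} \<union> insert (Suc (i + j)) {1..j}"
    using \<beta> length_avoiders[OF \<alpha>] length_avoiders[OF \<beta>] set_shift_avoiders
    by (simp add: join_def avoiders_iff)
  moreover have "distinct (join \<alpha> \<beta>)"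
  proof -
    let ?u = "map (\<lambda>x. x + length \<beta>) \<alpha>" and ?N = "Suc (length \<alpha> + length \<beta>)"
    have "distinct ?u" "distinct \<beta>"
      using \<alpha> \<beta> by (simp_all add: avoiders_iff distinct_map)
    moreover have "?N \<notin> set ?u" "?N \<notin> set \<beta>" "set ?u \<inter> set \<beta> = {}"
      using join_bounds by blast+
    ultimately show ?thesis
      unfolding join_def distinct_append by simp
  qed
  moreover have "\<not> has_132 (join \<alpha> \<beta>)"
    using \<alpha> \<beta> unfolding join_def has_132_join[OF join_bounds] by (simp add: avoiders_iff)
  moreover have "{j + 1..i + j} \<union> insert (Suc (i + j)) {1..j} = {1..Suc (i + j)}"
    by auto
  ultimately show ?thesis
    unfolding avoiders_iff by (simp only: simp_thms)
qed

lemma has_blocks_join_iff: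
  "a > 0 \<Longrightarrow> has_blocks a m (join \<alpha> \<beta>) \<longleftrightarrow>
     has_blocks a m \<alpha> \<or> has_blocks a m \<beta> \<or> has_blocks (a - 1) 0 \<alpha> \<and> has_blocks m 0 \<beta>"
  unfolding join_def using has_blocks_join[OF join_bounds] by simp

end

text \<open>\<open>Y\<close> is closed downwards in \<open>{1..n}\<close>, hence an initial
  segment.\<close>

lemma lower_part_eq:
  fixes X Y :: "nat set"
  assumes "X \<union> Y = {1..n}" and "\<forall>x\<in>X. \<forall>y\<in>Y. y < x"
  shows "Y = {1..card Y}"
proof -
  have fin: "finite Y"
    using assms(1) by (metis finite_Un finite_atLeastAtMost)
  have "\<exists>k. Y = {1..k}"
  proof (cases "Y = {}")
    case True
    thus ?thesis by (intro exI[of _ 0]) auto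
  next
    case False
    have "Y = {1..Max Y}"
    proof (intro equalityI subsetI)
      fix y assume "y \<in> Y"
      thus "y \<in> {1..Max Y}"
        using assms(1) fin by auto
    next
      fix y assume y: "y \<in> {1..Max Y}"
      have M: "Max Y \<in> Y"
        using False fin by simp
      hence "Max Y \<le> n"
        using assms(1) by auto
      hence "y \<in> X \<union> Y"
        using assms(1) y by auto
      thus "y \<in> Y"
        using assms(2) M y by fastforce
    qed
    thus ?thesis ..
  qed
  thus ?thesis by auto
qed

text \<open>An entry left of the maximum that is smaller than an entry right of it would complete a
  132. So the right part holds the smallest values, and lowering the left part by \<open>j\<close>
  makes it a permutation again.\<close>

lemma avoiders_Suc_cases:
  assumes "\<gamma> \<in> avoiders (Suc n)"
  obtains i \<alpha> \<beta> where "i \<le> n" "\<alpha> \<in> avoiders i" "\<beta> \<in> avoiders (n - i)" "\<gamma> = join \<alpha> \<beta>"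
proof -
  have \<gamma>: "set \<gamma> = {1..Suc n}" "distinct \<gamma>" "\<not> has_132 \<gamma>"
    using assms by (auto simp: avoiders_iff)
  hence "Suc n \<in> set \<gamma>" by simp
  then obtain u v where uv: "\<gamma> = u @ Suc n # v"
    by (auto simp: in_set_conv_decomp)
  have un: "set u \<union> set v = {1..n}"
  proof -
    have "set u \<union> set v = set \<gamma> - {Suc n}"
      using \<gamma>(2) uv by auto
    also have "\<dots> = {1..Suc n} - {Suc n}"
      by (simp only: \<gamma>(1))
    also have "\<dots> = {1..n}"
      by (simp add: atLeastAtMostSuc_conv)
    finally show ?thesis .
  qed
  have lt: "\<forall>x\<in>set u. \<forall>y\<in>set v. y < x"
  proof (intro ballI)
    fix x y assume xy: "x \<in> set u" "y \<in> set v"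
    hence "subseq ([x] @ [Suc n] @ [y]) (u @ [Suc n] @ v)"
      by (intro list_emb_append_mono) (auto simp: subseq_singleton_left)
    hence "subseq [x, Suc n, y] \<gamma>"
      using uv by simp
    moreover have "y \<in> {1..n}"
      using xy(2) un by blast
    hence "y < Suc n"
      by simp
    ultimately have "\<not> x < y"
      using \<gamma>(3) unfolding has_132_def by blast
    moreover have "x \<noteq> y"
      using \<gamma>(2) uv xy by auto
    ultimately show "y < x" by simp
  qed
  define j where "j = length v"
  have d: "distinct u" "distinct v" "set u \<inter> set v = {}"
    using \<gamma>(2) uv by auto
  have v: "set v = {1..j}"
    using lower_part_eq[OF un lt] d by (simp add: j_def distinct_card)
  have len: "length u + j = n"
    using un d card_Un_disjoint[of "set u" "set v"] by (simp add: j_def distinct_card)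
  have "set u = {1..n} - {1..j}"
    using un d(3) v by blast
  also have "{1..n} - {1..j} = {j + 1..n}"
    by auto
  finally have u: "set u = {j + 1..n}" .
  define \<alpha> where "\<alpha> = map (\<lambda>x. x - j) u"
  \<comment> \<open>The natural subtraction in \<open>\<alpha>\<close> is exact because all entries
    of \<open>u\<close> exceed \<open>j\<close>.\<close>
  have shift: "map (\<lambda>x. x + j) \<alpha> = u"
    unfolding \<alpha>_def map_map by (rule map_idI) (simp add: u)
  have "(\<lambda>x. x + j) ` set \<alpha> = set u"
    by (simp only: shift flip: set_map)
  also have "set u = {1 + j..length u + j}"
    unfolding u len by (simp only: add.commute)
  also have "\<dots> = (\<lambda>x. x + j) ` {1..length u}"
    by (rule image_add_atLeastAtMost'[symmetric])
  finally have "(\<lambda>x. x + j) ` set \<alpha> = (\<lambda>x. x + j) ` {1..length u}" .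
  hence set: "set \<alpha> = {1..length u}"
    by (subst (asm) inj_image_eq_iff) simp_all
  have "has_132 u \<longleftrightarrow> has_132 \<alpha>"
    using has_132_shift[of j \<alpha>] shift by simp
  moreover have "\<forall>x\<in>set u \<union> set v. x < Suc n"
    unfolding un by simp
  hence "\<not> has_132 u" "\<not> has_132 v"
    using \<gamma>(3) has_132_join[OF _ lt] unfolding uv by blast+
  moreover have "distinct \<alpha>"
    using d(1) shift by (metis distinct_map)
  ultimately have "\<alpha> \<in> avoiders (length u)" "v \<in> avoiders j"
    using set v d(2) by (simp_all add: avoiders_iff)
  moreover have "\<gamma> = join \<alpha> v"
    unfolding join_def j_def[symmetric] shift uv using len by (simp add: \<alpha>_def)
  moreover have "length u \<le> n" "j = n - length u"
    using len by auto
  ultimately show ?thesis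
    using that by blast
qed

text \<open>The maximum \<open>Suc n\<close> occurs only once, so both joins are cut at the same
  place; the right parts then agree, and with them the shifts of the left parts.\<close>

lemma join_inject:
  assumes "\<alpha> \<in> avoiders i" "\<beta> \<in> avoiders (n - i)" "\<alpha>' \<in> avoiders i'" "\<beta>' \<in> avoiders (n - i')"
    and "i \<le> n" "i' \<le> n" and eq: "join \<alpha> \<beta> = join \<alpha>' \<beta>'"
  shows "i = i' \<and> \<alpha> = \<alpha>' \<and> \<beta> = \<beta>'"
proof -
  note len = assms(1-4)[THEN length_avoiders]
  have N: "length \<alpha> + length \<beta> = n" "length \<alpha>' + length \<beta>' = n"
    using len assms by auto
  have "Suc n \<notin> set (map (\<lambda>x. x + length \<beta>) \<alpha>)" "Suc n \<notin> set \<beta>"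
    using join_bounds(1)[OF assms(1,2)] N by fastforce+
  from append_Cons_eq_iff[OF this]
  have *: "map (\<lambda>x. x + length \<beta>) \<alpha> = map (\<lambda>x. x + length \<beta>') \<alpha>' \<and> \<beta> = \<beta>'"
    using eq unfolding join_def N by blast
  hence "map (\<lambda>x. x + length \<beta>) \<alpha> = map (\<lambda>x. x + length \<beta>) \<alpha>'"
    by (elim conjE) (simp only:)
  hence "\<alpha> = \<alpha>'"
    by (rule map_injective) (simp add: inj_def)
  thus ?thesis
    using * len by auto
qed

text \<open>The Catalan recursion, refined by a property \<open>P\<close>: joining is a bijection
  from the pairs, sorted by the length of the left part.\<close>

lemma card_avoiders_Suc:
  "card {\<gamma> \<in> avoiders (Suc n). P \<gamma>} =
     (\<Sum>i=0..n. card {(\<alpha>, \<beta>). \<alpha> \<in> avoiders i \<and> \<beta> \<in> avoiders (n - i) \<and> P (join \<alpha> \<beta>)})"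
proof -
  let ?B = "\<lambda>i. {(\<alpha>, \<beta>). \<alpha> \<in> avoiders i \<and> \<beta> \<in> avoiders (n - i) \<and> P (join \<alpha> \<beta>)}"
  have fin: "finite (?B i)" for i
    by (rule finite_subset[of _ "avoiders i \<times> avoiders (n - i)"]) auto
  have "bij_betw (\<lambda>(i, \<alpha>, \<beta>). join \<alpha> \<beta>) (SIGMA i:{0..n}. ?B i) {\<gamma> \<in> avoiders (Suc n). P \<gamma>}"
  proof (rule bij_betwI')
    fix x y assume "x \<in> (SIGMA i:{0..n}. ?B i)" "y \<in> (SIGMA i:{0..n}. ?B i)"
    thus "((\<lambda>(i, \<alpha>, \<beta>). join \<alpha> \<beta>) x = (\<lambda>(i, \<alpha>, \<beta>). join \<alpha> \<beta>) y) = (x = y)"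
      using join_inject by fastforce
  next
    fix x assume "x \<in> (SIGMA i:{0..n}. ?B i)"
    then obtain i \<alpha> \<beta> where "x = (i, \<alpha>, \<beta>)" "i \<le> n" "\<alpha> \<in> avoiders i" "\<beta> \<in> avoiders (n - i)"
      "P (join \<alpha> \<beta>)" by auto
    thus "(\<lambda>(i, \<alpha>, \<beta>). join \<alpha> \<beta>) x \<in> {\<gamma> \<in> avoiders (Suc n). P \<gamma>}"
      using join_in_avoiders[of \<alpha> i \<beta> "n - i"] by simp
  next
    fix \<gamma> assume "\<gamma> \<in> {\<gamma> \<in> avoiders (Suc n). P \<gamma>}"
    then obtain i \<alpha> \<beta> where "i \<le> n" "\<alpha> \<in> avoiders i" "\<beta> \<in> avoiders (n - i)" "\<gamma> = join \<alpha> \<beta>" "P \<gamma>"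
      by (auto elim: avoiders_Suc_cases)
    thus "\<exists>x\<in>(SIGMA i:{0..n}. ?B i). \<gamma> = (\<lambda>(i, \<alpha>, \<beta>). join \<alpha> \<beta>) x"
      by (intro bexI[of _ "(i, \<alpha>, \<beta>)"]) auto
  qed
  from bij_betw_same_card[OF this] fin show ?thesis
    by simp
qed

section \<open>Recurrence and functional equation for the generating functions\<close>

definition block_free :: "nat \<Rightarrow> nat \<Rightarrow> nat \<Rightarrow> nat list set" where
  "block_free a m n = {\<gamma> \<in> avoiders n. \<not> has_blocks a m \<gamma>}"

definition block_gf :: "nat \<Rightarrow> nat \<Rightarrow> real fps" where
  "block_gf a m = Abs_fps (\<lambda>n. real (card (block_free a m n)))"

lemma finite_block_free [simp]: "finite (block_free a m n)"
  by (simp add: block_free_def)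

lemma avoid_gf_two_block: "avoid_gf (two_block (a + m) m) = block_gf a m"
proof -
  have "avoid_count (two_block (a + m) m) n = card (block_free a m n)" for n
    unfolding avoid_count_def block_free_def avoiders_def contains_132_iff contains_two_block_iff
    by (rule arg_cong[of _ _ card]) auto
  thus ?thesis
    by (simp add: avoid_gf_def block_gf_def)
qed

lemma has_blocks_0_right: "subseq xs \<gamma> \<Longrightarrow> sorted_wrt (<) xs \<Longrightarrow> has_blocks (length xs) 0 \<gamma>"
  unfolding has_blocks_def by (intro exI[of _ xs] exI[of _ "[]"]) simp

text \<open>These implications give the inclusions between avoidance classes that the
  inclusion-exclusion count relies on.\<close>

lemma has_blocks_imp_increasing:
  assumes "has_blocks a m \<gamma>"
  shows "has_blocks (a - 1) 0 \<gamma>" and "has_blocks m 0 \<gamma>"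
proof -
  obtain xs ys where xy: "length xs = a" "length ys = m" "subseq (xs @ ys) \<gamma>"
    "sorted_wrt (<) (ys @ xs)"
    using assms by (auto simp: has_blocks_def)
  have "subseq ys (xs @ ys)" "subseq (take (a - 1) xs) (xs @ ys)"
    by (auto intro: prefix_imp_subseq suffix_imp_subseq take_is_prefix prefix_prefix)
  hence "subseq ys \<gamma>" "subseq (take (a - 1) xs) \<gamma>"
    using xy(3) subseq_order.order_trans by blast+
  moreover have "sorted_wrt (<) ys" "sorted_wrt (<) (take (a - 1) xs)"
    using xy(4) by (auto simp: sorted_wrt_append sorted_wrt_take)
  ultimately show "has_blocks (a - 1) 0 \<gamma>" "has_blocks m 0 \<gamma>"
    using has_blocks_0_right[of ys] has_blocks_0_right[of "take (a - 1) xs"] xy(1,2) by simp_all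
qed

text \<open>A join is free of the pattern iff both parts are and, in addition,
  \<open>\<alpha>\<close> has no increasing subsequence of length \<open>a - 1\<close> or
  \<open>\<beta>\<close> none of length \<open>m\<close>. Inclusion-exclusion over this last
  alternative gives the three products.\<close>

lemma card_block_free_Suc:
  assumes "a > 0"
  shows "real (card (block_free a m (Suc n))) =
    (\<Sum>i=0..n. real (card (block_free (a - 1) 0 i)) * real (card (block_free a m (n - i)))
           + real (card (block_free a m i)) * real (card (block_free m 0 (n - i)))
           - real (card (block_free (a - 1) 0 i)) * real (card (block_free m 0 (n - i))))"
proof -
  have "real (card {(\<alpha>, \<beta>). \<alpha> \<in> avoiders i \<and> \<beta> \<in> avoiders (n - i) \<and> \<not> has_blocks a m (join \<alpha> \<beta>)}) =
      real (card (block_free (a - 1) 0 i)) * real (card (block_free a m (n - i)))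
           + real (card (block_free a m i)) * real (card (block_free m 0 (n - i)))
           - real (card (block_free (a - 1) 0 i)) * real (card (block_free m 0 (n - i)))" for i
  proof -
    let ?X = "block_free (a - 1) 0 i" and ?X' = "block_free a m i"
    let ?Y = "block_free m 0 (n - i)" and ?Y' = "block_free a m (n - i)"
    have sub: "?X \<subseteq> ?X'" "?Y \<subseteq> ?Y'"
      using has_blocks_imp_increasing by (auto simp: block_free_def)
    have "{(\<alpha>, \<beta>). \<alpha> \<in> avoiders i \<and> \<beta> \<in> avoiders (n - i) \<and> \<not> has_blocks a m (join \<alpha> \<beta>)} =
        ?X \<times> ?Y' \<union> ?X' \<times> ?Y"
      using has_blocks_imp_increasing has_blocks_join_iff[OF _ _ \<open>a > 0\<close>]
      by (auto simp: block_free_def)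
    moreover have "?X \<times> ?Y' \<inter> ?X' \<times> ?Y = ?X \<times> ?Y"
      using sub by auto
    moreover have "card (?X \<times> ?Y') + card (?X' \<times> ?Y) =
        card (?X \<times> ?Y' \<union> ?X' \<times> ?Y) + card (?X \<times> ?Y' \<inter> ?X' \<times> ?Y)"
      by (rule card_Un_Int) auto
    ultimately show ?thesis
      by (simp flip: of_nat_mult add: card_cartesian_product)
  qed
  thus ?thesis
    unfolding block_free_def card_avoiders_Suc of_nat_sum by (simp only: )
qed

text \<open>The sums in the recurrence are Cauchy products; the summand 1 counts the empty
  permutation, which is free of the pattern because \<open>a > 0\<close>.\<close>

lemma block_gf_eq:
  assumes "a > 0"
  shows "block_gf a m = 1 + fps_X * (block_gf (a - 1) 0 * block_gf a m + block_gf a m * block_gf m 0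
           - block_gf (a - 1) 0 * block_gf m 0)"
proof (rule fps_ext)
  fix n
  show "fps_nth (block_gf a m) n = fps_nth (1 + fps_X * (block_gf (a - 1) 0 * block_gf a m
          + block_gf a m * block_gf m 0 - block_gf (a - 1) 0 * block_gf m 0)) n"
  proof (cases n)
    case 0
    have "block_free a m 0 = {[]}"
      using assms by (auto simp: block_free_def avoiders_0 has_blocks_def)
    thus ?thesis
      by (simp add: 0 block_gf_def)
  next
    case (Suc n')
    have *: "fps_nth (1 + fps_X * f) (Suc n') = fps_nth f n'" for f :: "real fps"
      by simp
    show ?thesis
      unfolding Suc * by (simp add: block_gf_def card_block_free_Suc[OF assms] fps_mult_nth
          sum.distrib sum_subtractf)
  qed
qed

text \<open>The empty sequence occurs in every permutation. This boundary value makes the functional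
  equation degenerate as needed for \<open>m = 0\<close> and for \<open>a = 1\<close>.\<close>

lemma block_gf_0: "block_gf 0 0 = 0"
  by (rule fps_ext) (simp add: block_gf_def block_free_def has_blocks_def)

section \<open>Solution in terms of Chebyshev polynomials\<close>

definition V :: "nat \<Rightarrow> real fps" where
  "V p = fps_of_poly (cheb_V p)"

lemma V_Suc_Suc: "V (Suc (Suc p)) = V (Suc p) - fps_X * V p"
  by (simp add: V_def fps_of_poly_diff fps_of_poly_mult fps_of_poly_pCons)

lemma V_0: "V 0 = 1" and V_1: "V (Suc 0) = 1"
  by (simp_all add: V_def)

lemma V_nonzero: "V p \<noteq> 0"
  unfolding V_def by (metis coeff_0_cheb_V fps_of_poly_nth fps_zero_nth zero_neq_one)

text \<open>Both sides satisfy the recurrence of \<open>V\<close> in \<open>m\<close>, so two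
  initial values suffice.\<close>

lemma V_add: "V (Suc a + Suc m) = V (Suc a) * V (Suc m) - fps_X * V a * V m"
proof (induction m rule: cheb_V.induct)
  case 1
  show ?case using V_Suc_Suc[of a] by (simp add: V_0 V_1)
next
  case 2
  show ?case
    by (simp add: V_Suc_Suc V_0 V_1 algebra_simps)
next
  case (3 m)
  have *: "V (Suc a + Suc (Suc (Suc m))) = V (Suc a + Suc (Suc m)) - fps_X * V (Suc a + Suc m)"
    using V_Suc_Suc[of "Suc a + Suc m"] by simp
  show ?case
    unfolding * 3 by (simp add: V_Suc_Suc algebra_simps)
qed

text \<open>For \<open>m = 0\<close> the functional equation reads \<open>F = 1 + x G F\<close> with
  \<open>G\<close> the series for length one less; this is the continued fraction step matching the
  recurrence of \<open>V\<close>.\<close>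

lemma block_gf_increasing: "block_gf (Suc a) 0 * V (Suc a) = V a"
proof (induction a)
  case 0
  show ?case
    using block_gf_eq[of "Suc 0" 0] by (simp add: block_gf_0 V_0 V_1)
next
  case (Suc a)
  let ?F = "block_gf (Suc (Suc a)) 0" and ?G = "block_gf (Suc a) 0"
  have F: "?F = 1 + fps_X * ?G * ?F"
    using block_gf_eq[of "Suc (Suc a)" 0] by (simp add: block_gf_0 mult_ac)
  have "?F * V (Suc (Suc a)) = ?F * V (Suc a) - fps_X * ?F * (?G * V (Suc a))"
    unfolding V_Suc_Suc Suc by (simp add: algebra_simps)
  also have "\<dots> = (?F - fps_X * ?G * ?F) * V (Suc a)"
    by (simp add: algebra_simps)
  also have "?F - fps_X * ?G * ?F = 1"
    using F by (simp add: algebra_simps)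
  finally show ?case by simp
qed

text \<open>The functional equation is linear in the unknown series, with known coefficients. The
  case \<open>a = 0\<close> is separate because its coefficient \<open>block_gf 0 0\<close> is zero
  and not a quotient of two consecutive \<open>V\<close>.\<close>

lemma block_gf_mult_V: "block_gf (Suc a) (Suc m) * V (Suc a + Suc m) = V (Suc a + m)"
proof (cases a)
  case 0
  let ?F = "block_gf (Suc 0) (Suc m)" and ?H = "block_gf (Suc m) 0"
  have "?F = 1 + fps_X * ?F * ?H"
    using block_gf_eq[of "Suc 0" "Suc m"] by (simp add: block_gf_0 mult_ac)
  hence "V (Suc m) = ?F * V (Suc m) - fps_X * ?F * (?H * V (Suc m))"
    by (metis (no_types, opaque_lifting) add_diff_cancel_right' left_diff_distrib mult.assoc mult_1)
  also have "\<dots> = ?F * V (Suc (Suc m))"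
    unfolding block_gf_increasing V_Suc_Suc by (simp add: algebra_simps)
  finally show ?thesis using 0 by simp
next
  case (Suc b)
  let ?F = "block_gf (Suc (Suc b)) (Suc m)" and ?G = "block_gf (Suc b) 0" and ?H = "block_gf (Suc m) 0"
  let ?p = "V (Suc b)" and ?q = "V (Suc m)"
  have G: "?G * ?p = V b" and H: "?H * ?q = V m"
    by (rule block_gf_increasing)+
  have F: "?F = 1 + fps_X * (?G * ?F + ?F * ?H - ?G * ?H)"
    using block_gf_eq[of "Suc (Suc b)" "Suc m"] by simp
  \<comment> \<open>Multiplication by \<open>?p * ?q\<close> clears the denominators of
    \<open>?G\<close> and \<open>?H\<close>.\<close>
  hence "?F * ?p * ?q = (1 + fps_X * (?G * ?F + ?F * ?H - ?G * ?H)) * ?p * ?q"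
    by simp
  also have "\<dots> = ?p * ?q + fps_X * ((?G * ?p) * ?F * ?q + ?F * ?p * (?H * ?q) - (?G * ?p) * (?H * ?q))"
    by (simp add: algebra_simps)
  finally have "?F * (?p * ?q - fps_X * V b * ?q - fps_X * ?p * V m) = ?p * ?q - fps_X * V b * V m"
    unfolding G H by (simp add: algebra_simps)
  \<comment> \<open>The first two terms combine to \<open>V (Suc (Suc b)) * ?q\<close> by the
    recurrence, after which the addition formula applies.\<close>
  moreover have "?p * ?q - fps_X * V b * ?q - fps_X * ?p * V m = V (Suc (Suc b) + Suc m)"
    using V_add[of "Suc b" m] V_Suc_Suc[of b] by (simp add: algebra_simps)
  moreover have "?p * ?q - fps_X * V b * V m = V (Suc (Suc b) + m)"
    using V_add[of b m] by simp
  ultimately show ?thesis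
    using Suc by simp
qed

theorem theorem2p4:
  fixes k m :: nat
  assumes "k > m" and "m > 0"
  shows "avoid_gf (two_block k m) = R k"
proof -
  obtain a where a: "k = Suc a + m"
    using assms(1) by (metis add.commute less_imp_Suc_add add_Suc_right)
  obtain b where b: "m = Suc b"
    using assms(2) by (cases m) auto
  have "block_gf (Suc a) m * V k = V (k - 1)"
    using block_gf_mult_V[of a b] by (simp add: a b)
  hence "block_gf (Suc a) m = V (k - 1) / V k"
    using V_nonzero by (metis nonzero_mult_div_cancel_right)
  thus ?thesis
    using R_rational(1)[of k, folded V_def] assms avoid_gf_two_block[of "Suc a" m] a by simp
qed

end
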